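(* Let $G$ be a graph on $n$ vertices with independence number $\alpha(G)=2$. Then $\operatorname{lcc}(G)+\operatorname{lcc}(\overline{G})\leq n$.
   Context: All graphs are finite, simple and undirected; $\overline{G}$ denotes the complement of $G$. A clique of $G$ is a set of pairwise adjacent vertices. A clique covering of $E(G)$ is a family $\mathcal{C}$ of cliques of $G$ such that every edge of $G$ lies in at least one member of $\mathcal{C}$. For a vertex $v$, its valency $val_{\mathcal{C}}(v)$ is the number of cliques in $\mathcal{C}$ containing $v$. The local clique cover number $\operatorname{lcc}(G)$ is the smallest integer $k$ such that there is a clique covering $\mathcal{C}$ of $E(G)$ with $val_{\mathcal{C}}(v)\le k$ for every vertex $v$ of $G$. *)

theory Defs
  imports Main "HOL-Library.Ramsey"
begin

text \<open>
  A graph is a pair of a vertex set and a set of edges, each edge being a two-element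
  set of vertices.
\<close>

definition fin_simple_graph :: "'a set \<Rightarrow> 'a set set \<Rightarrow> bool" where
  "fin_simple_graph V E \<longleftrightarrow> finite V \<and> E \<subseteq> [V]\<^bsup>2\<^esup>"

definition compl_edges :: "'a set \<Rightarrow> 'a set set \<Rightarrow> 'a set set" where
  "compl_edges V E = [V]\<^bsup>2\<^esup> - E"

definition is_clique :: "'a set \<Rightarrow> 'a set set \<Rightarrow> 'a set \<Rightarrow> bool" where
  "is_clique V E K \<longleftrightarrow> K \<subseteq> V \<and> pairwise (\<lambda>u v. {u, v} \<in> E) K"

definition is_indep :: "'a set \<Rightarrow> 'a set set \<Rightarrow> 'a set \<Rightarrow> bool" where
  "is_indep V E S \<longleftrightarrow> S \<subseteq> V \<and> pairwise (\<lambda>u v. {u, v} \<notin> E) S"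

definition indep_num :: "'a set \<Rightarrow> 'a set set \<Rightarrow> nat" where
  "indep_num V E = Max (card ` {S. is_indep V E S})"

definition clique_covering :: "'a set \<Rightarrow> 'a set set \<Rightarrow> 'a set set \<Rightarrow> bool" where
  "clique_covering V E \<C> \<longleftrightarrow> (\<forall>K\<in>\<C>. is_clique V E K) \<and> (\<forall>e\<in>E. \<exists>K\<in>\<C>. e \<subseteq> K)"

definition valency :: "'a set set \<Rightarrow> 'a \<Rightarrow> nat" where
  "valency \<C> v = card {K \<in> \<C>. v \<in> K}"

definition lcc :: "'a set \<Rightarrow> 'a set set \<Rightarrow> nat" where
  "lcc V E = (LEAST k. \<exists>\<C>. clique_covering V E \<C> \<and> (\<forall>v\<in>V. valency \<C> v \<le> k))"

text \<open>
  For a finite graph the families and sets involved are finite, so neither \<open>card\<close> nor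
  \<open>Max\<close> takes a default value, and \<open>LEAST\<close> ranges over a nonempty set.
\<close>

lemma fin_simple_graph_compl:
  "fin_simple_graph V E \<Longrightarrow> fin_simple_graph V (compl_edges V E)"
  by (auto simp: fin_simple_graph_def compl_edges_def)

lemma finite_clique_covering:
  assumes "finite V" "clique_covering V E \<C>"
  shows "finite \<C>"
proof (rule finite_subset)
  show "\<C> \<subseteq> Pow V"
    using assms by (auto simp: clique_covering_def is_clique_def)
qed (use assms in simp)

lemma indep_sets_finite_nonempty:
  assumes "finite V"
  shows "finite {S. is_indep V E S}" and "{S. is_indep V E S} \<noteq> {}"
proof -
  have "{S. is_indep V E S} \<subseteq> Pow V" by (auto simp: is_indep_def)
  then show "finite {S. is_indep V E S}" by (rule finite_subset) (use assms in simp)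
  have "is_indep V E {}" by (simp add: is_indep_def)
  then show "{S. is_indep V E S} \<noteq> {}" by blast
qed

lemma edges_clique_covering:
  assumes "fin_simple_graph V E"
  shows "clique_covering V E E"
proof -
  have "is_clique V E e" if "e \<in> E" for e
  proof -
    from that assms have "e \<in> [V]\<^bsup>2\<^esup>" by (auto simp: fin_simple_graph_def)
    then obtain x y where "e = {x, y}" "x \<in> V" "y \<in> V" by (rule nsets2_E)
    with that show ?thesis by (auto simp: is_clique_def pairwise_def insert_commute)
  qed
  then show ?thesis by (auto simp: clique_covering_def)
qed

lemma lcc_attained:
  assumes "fin_simple_graph V E"
  shows "\<exists>\<C>. clique_covering V E \<C> \<and> (\<forall>v\<in>V. valency \<C> v \<le> lcc V E)"
proof -
  have fin: "finite E"
    using assms finite_imp_finite_nsets finite_subset by (auto simp: fin_simple_graph_def)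
  have "\<exists>\<C>. clique_covering V E \<C> \<and> (\<forall>v\<in>V. valency \<C> v \<le> card E)"
    using edges_clique_covering[OF assms] fin
    by (intro exI[of _ E]) (auto simp: valency_def intro: card_mono)
  then show ?thesis unfolding lcc_def by (rule LeastI)
qed

end

theory Submission
  imports Defs
begin

text \<open>
  Covering the complement \<open>H\<close> of \<open>G\<close> by its edges gives \<open>lcc H \<le> \<Delta>(H)\<close>. Let \<open>v\<close> attain \<open>\<Delta>(H)\<close>, let \<open>A\<close> be
  its neighbourhood in \<open>H\<close> and \<open>B = V - A\<close>. As \<open>H\<close> is triangle-free, \<open>A\<close> is a clique of \<open>G\<close>. Cover \<open>G\<close> by
  \<open>A\<close>, the cliques \<open>{b} \<union> (N\<^sub>G(b) \<inter> A)\<close> for \<open>b \<in> B - {v}\<close> and the edges inside \<open>B\<close>; the vertex \<open>v\<close> has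
  no \<open>G\<close>-neighbour in \<open>A\<close>, so it needs no clique. Every valency is then at most
  \<open>1 + (|B| - 1) = n - \<Delta>(H)\<close>.
\<close>

lemma lcc_le:
  assumes "clique_covering V E \<C>" and "\<And>v. v \<in> V \<Longrightarrow> valency \<C> v \<le> k"
  shows "lcc V E \<le> k"
  unfolding lcc_def using assms by (blast intro: Least_le)

definition nbrs :: "'a set \<Rightarrow> 'a set set \<Rightarrow> 'a \<Rightarrow> 'a set" where
  "nbrs V E v = {u \<in> V. {u, v} \<in> E}"

lemma edge_cases:
  assumes "fin_simple_graph V E" "e \<in> E"
  obtains x y where "e = {x, y}" "x \<in> V" "y \<in> V" "x \<noteq> y"
proof -
  from assms have "e \<in> [V]\<^bsup>2\<^esup>" by (auto simp: fin_simple_graph_def)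
  then show thesis by (rule nsets2_E) (rule that)
qed

text \<open>The covering is \<open>E\<close> itself: its members through \<open>v\<close> are the
  sets \<open>{u, v}\<close> with \<open>u\<close> a neighbour of \<open>v\<close>. The bound is
  applied to the complement graph.\<close>

lemma lcc_le_max_degree:
  assumes G: "fin_simple_graph V E" and d: "\<And>v. v \<in> V \<Longrightarrow> card (nbrs V E v) \<le> d"
  shows "lcc V E \<le> d"
proof (rule lcc_le[OF edges_clique_covering[OF G]])
  fix v assume v: "v \<in> V"
  have fin: "finite (nbrs V E v)"
    using G by (simp add: nbrs_def fin_simple_graph_def)
  have "e \<in> (\<lambda>u. {u, v}) ` nbrs V E v" if "e \<in> E" "v \<in> e" for e
  proof -
    obtain x y where "e = {x, y}" "x \<in> V" "y \<in> V"
      using edge_cases[OF G \<open>e \<in> E\<close>] by metis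
    with \<open>v \<in> e\<close> obtain u where "u \<in> V" "e = {u, v}" by auto
    with \<open>e \<in> E\<close> show ?thesis by (auto simp: nbrs_def)
  qed
  then have "{e \<in> E. v \<in> e} \<subseteq> (\<lambda>u. {u, v}) ` nbrs V E v" by blast
  then have "valency E v \<le> card (nbrs V E v)"
    unfolding valency_def by (rule surj_card_le[OF fin])
  with d[OF v] show "valency E v \<le> d" by linarith
qed

lemma card_le_indep_num:
  assumes "finite V" "is_indep V E S"
  shows "card S \<le> indep_num V E"
  unfolding indep_num_def
  using indep_sets_finite_nonempty[OF assms(1)] assms(2) by (intro Max_ge) auto

lemma doubleton_in_compl_edges_iff:
  "{u, v} \<in> compl_edges V E \<longleftrightarrow> u \<in> V \<and> v \<in> V \<and> u \<noteq> v \<and> {u, v} \<notin> E"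
  by (auto simp: compl_edges_def nsets_def card_insert_if)

text \<open>Two nonadjacent members would form, together with \<open>v\<close>, an independent set
  of size three.\<close>

lemma is_clique_nbrs_compl:
  assumes G: "fin_simple_graph V E" and \<alpha>: "indep_num V E \<le> 2" and v: "v \<in> V"
  shows "is_clique V E (nbrs V (compl_edges V E) v)"
  unfolding is_clique_def
proof (intro conjI pairwiseI)
  fix x y
  assume "x \<in> nbrs V (compl_edges V E) v" "y \<in> nbrs V (compl_edges V E) v" and xy: "x \<noteq> y"
  then have xyv: "x \<in> V" "y \<in> V" "x \<noteq> v" "y \<noteq> v" "{x, v} \<notin> E" "{y, v} \<notin> E"
    by (auto simp: nbrs_def doubleton_in_compl_edges_iff)
  show "{x, y} \<in> E"
  proof (rule ccontr)
    assume "{x, y} \<notin> E"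
    with xyv v have "is_indep V E {x, y, v}"
      by (auto simp: is_indep_def pairwise_def insert_commute)
    then have "card {x, y, v} \<le> 2"
      using card_le_indep_num[of V E] G \<alpha> by (fastforce simp: fin_simple_graph_def)
    with xyv xy show False by simp
  qed
qed (auto simp: nbrs_def)

text \<open>Here \<open>v\<close> is any vertex whose non-neighbours form a clique; its degree in
  the complement is made maximal only when the two bounds are added.\<close>

lemma lcc_le_card_minus_nbrs_compl:
  assumes G: "fin_simple_graph V E" and v: "v \<in> V"
    and clq: "is_clique V E (nbrs V (compl_edges V E) v)"
  shows "lcc V E \<le> card (V - nbrs V (compl_edges V E) v)"
proof -
  define A where "A = nbrs V (compl_edges V E) v"
  define B where "B = V - A"
  \<comment> \<open>One clique takes all edges from \<open>b\<close> to \<open>A\<close> at once, so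
    these edges cost \<open>b\<close> only one unit of valency.\<close>
  define C where "C b = insert b {a \<in> A. {a, b} \<in> E}" for b
  define \<C> where "\<C> = {A} \<union> C ` (B - {v}) \<union> {e \<in> E. e \<subseteq> B}"
  have A: "A \<subseteq> V" "\<And>a a'. a \<in> A \<Longrightarrow> a' \<in> A \<Longrightarrow> a \<noteq> a' \<Longrightarrow> {a, a'} \<in> E"
    using clq by (auto simp: is_clique_def A_def pairwise_def)
  have finB: "finite B" using G by (auto simp: B_def fin_simple_graph_def)
  have vB: "v \<in> B"
    using v by (auto simp: B_def A_def nbrs_def doubleton_in_compl_edges_iff)
  have vA: "{a, v} \<notin> E" if "a \<in> A" for a
    using that by (auto simp: A_def nbrs_def doubleton_in_compl_edges_iff)
  have "is_clique V E K" if "K \<in> \<C>" for K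
  proof -
    consider "K = A" | b where "b \<in> B" "K = C b" | "K \<in> E"
      using \<open>K \<in> \<C>\<close> unfolding \<C>_def by blast
    then show ?thesis
    proof cases
      case 1
      with clq show ?thesis by (simp add: A_def)
    next
      case 2
      with A show ?thesis
        by (auto simp: is_clique_def C_def B_def pairwise_def insert_commute)
    next
      case 3
      with edges_clique_covering[OF G] show ?thesis by (auto simp: clique_covering_def)
    qed
  qed
  moreover have "\<exists>K\<in>\<C>. e \<subseteq> K" if e: "e \<in> E" for e
  proof -
    obtain x y where xy: "e = {x, y}" "x \<in> V" "y \<in> V"
      using edge_cases[OF G e] by metis
    \<comment> \<open>By \<open>vA\<close> the endpoint \<open>b\<close> differs from
      \<open>v\<close>, so \<open>C b\<close> does belong to \<open>\<C>\<close>.\<close>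
    have mixed: "\<exists>K\<in>\<C>. {a, b} \<subseteq> K" if "a \<in> A" "b \<in> B" "{a, b} \<in> E" for a b
      using that vA by (intro bexI[of _ "C b"]) (auto simp: C_def \<C>_def)
    consider "x \<in> A" "y \<in> A" | "x \<in> A" "y \<in> B" | "x \<in> B" "y \<in> A" | "x \<in> B" "y \<in> B"
      using xy by (auto simp: B_def)
    then show ?thesis
    proof cases
      case 1
      then show ?thesis using xy by (auto simp: \<C>_def)
    next
      case 2
      then show ?thesis using mixed[of x y] xy e by simp
    next
      case 3
      then show ?thesis using mixed[of y x] xy e by (simp add: insert_commute)
    next
      case 4
      then have "e \<in> \<C>" using xy e by (simp add: \<C>_def)
      then show ?thesis by blast
    qed
  qed
  ultimately have "clique_covering V E \<C>" by (simp add: clique_covering_def)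
  moreover have "valency \<C> w \<le> card B" if w: "w \<in> V" for w
  proof -
    \<comment> \<open>Shared count for both cases: one special clique \<open>K\<close>, plus at most
      one clique for each vertex of \<open>B\<close> other than \<open>u\<close>. The omitted
      \<open>u\<close> pays for \<open>K\<close>. An image suffices, so coinciding cliques do no
      harm.\<close>
    have bound: "valency \<C> w \<le> card B"
      if u: "u \<in> B" and sub: "{K \<in> \<C>. w \<in> K} \<subseteq> insert K (f ` (B - {u}))" for K f u
    proof -
      have "valency \<C> w \<le> card (insert K (f ` (B - {u})))"
        unfolding valency_def using finB sub by (intro card_mono) auto
      also have "\<dots> \<le> Suc (card (f ` (B - {u})))" by (rule card_insert_le_m1) simp_all
      also have "\<dots> \<le> Suc (card (B - {u}))" using finB by (simp add: card_image_le)
      also have "\<dots> = card B" using finB u by (rule card_Suc_Diff1)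
      finally show ?thesis .
    qed
    show ?thesis
    proof (cases "w \<in> A")
      case True
      \<comment> \<open>No edge inside \<open>B\<close> contains \<open>w\<close>; the omitted
        vertex is \<open>v\<close>.\<close>
      then have "{K \<in> \<C>. w \<in> K} \<subseteq> insert A (C ` (B - {v}))"
        by (auto simp: \<C>_def B_def)
      with vB show ?thesis by (rule bound)
    next
      case False
      then have "w \<in> B" using w by (simp add: B_def)
      \<comment> \<open>As \<open>w\<close> lies outside \<open>A\<close>, the only
        \<open>C b\<close> that can contain it is \<open>C w\<close>; the rest are edges inside
        \<open>B\<close>, indexed by their other endpoint. For \<open>w = v\<close> the set
        \<open>C w\<close> need not be in \<open>\<C>\<close>, which the inclusion allows.\<close>
      moreover have "{K \<in> \<C>. w \<in> K} \<subseteq> insert (C w) ((\<lambda>u. {u, w}) ` (B - {w}))"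
      proof
        fix K assume "K \<in> {K \<in> \<C>. w \<in> K}"
        then have K: "K \<in> \<C>" "w \<in> K" by auto
        consider "K = C w" | "K \<in> E" "K \<subseteq> B"
          using K False by (auto simp: \<C>_def C_def)
        then show "K \<in> insert (C w) ((\<lambda>u. {u, w}) ` (B - {w}))"
        proof cases
          case 1
          then show ?thesis by simp
        next
          case 2
          obtain x y where xy: "K = {x, y}" "x \<noteq> y"
            using edge_cases[OF G \<open>K \<in> E\<close>] by metis
          with K(2) obtain u where "K = {u, w}" "u \<noteq> w" by auto
          with 2 show ?thesis by auto
        qed
      qed
      ultimately show ?thesis by (rule bound)
    qed
  qed
  ultimately have "lcc V E \<le> card B" by (rule lcc_le)
  then show ?thesis by (simp add: B_def A_def)
qed

theorem theorem5:
  fixes V :: "'a set" and E :: "'a set set" and n :: nat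
  assumes "fin_simple_graph V E"
    and "card V = n"
    and "indep_num V E = 2"
  shows "lcc V E + lcc V (compl_edges V E) \<le> n"
proof -
  let ?d = "\<lambda>v. card (nbrs V (compl_edges V E) v)"
  have fin: "finite V" using assms(1) by (simp add: fin_simple_graph_def)
  \<comment> \<open>Without vertices the independence number would be 0. Nonemptiness ensures that
    the maximum degree below is attained.\<close>
  have "V \<noteq> {}"
  proof
    assume "V = {}"
    then have "{S. is_indep V E S} = {{}}" by (auto simp: is_indep_def)
    with assms(3) show False by (simp add: indep_num_def)
  qed
  then have "Max (?d ` V) \<in> ?d ` V" using fin by (intro Max_in) auto
  then obtain v where v: "v \<in> V" and "?d v = Max (?d ` V)" by auto
  then have max: "?d u \<le> ?d v" if "u \<in> V" for u
    using that fin by simp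
  have "lcc V (compl_edges V E) \<le> ?d v"
    using fin_simple_graph_compl[OF assms(1)] max by (rule lcc_le_max_degree)
  moreover have "lcc V E \<le> card (V - nbrs V (compl_edges V E) v)"
    using assms v by (intro lcc_le_card_minus_nbrs_compl is_clique_nbrs_compl) auto
  \<comment> \<open>The inclusion gives \<open>card (V - N) = n - d\<close> for the neighbourhood
    \<open>N\<close> of size \<open>d\<close>, and also \<open>d \<le> n\<close>, so the subtraction
    on naturals does not truncate and the two bounds add up to \<open>n\<close>.\<close>
  moreover have sub: "nbrs V (compl_edges V E) v \<subseteq> V" by (auto simp: nbrs_def)
  ultimately show ?thesis
    using assms(2) fin card_Diff_subset[OF finite_subset[OF sub fin] sub] card_mono[OF fin sub]
    by linarith
qed

end
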